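(* Let $P$ be a convex equal-area polygon. Then $M_{i+\frac12}$ is an endpoint of the affine distance symmetry set of $P$ if and only if $M_{i+\frac12}$ is a cusp of the affine evolute of $P$.
   Context: $[u,v]$ denotes the determinant of two plane vectors. A convex equal-area polygon $P$ is a simple polygon bounding a convex planar domain, with vertices $P_1,\dots,P_n\in\mathbb{R}^2$, $n\ge5$ (all indices modulo $n$) and oriented sides $\mathbf{v}_{i+\frac12}=P_{i+1}-P_i$, such that $[\mathbf{v}_{i-\frac12},\mathbf{v}_{i+\frac12}]=[\mathbf{v}_{i+\frac12},\mathbf{v}_{i+\frac32}]$ for every $i$; by an affine transformation this common determinant is normalized to be $1$. The affine normal vector at $P_i$ is $\mathbf{n}_i=\mathbf{v}_{i+\frac12}-\mathbf{v}_{i-\frac12}$, and the discrete affine curvature $\mu_{i+\frac12}$ is defined by $\mathbf{n}_{i+1}-\mathbf{n}_i=-\mu_{i+\frac12}\mathbf{v}_{i+\frac12}$. For $\lambda\in\mathbb{R}$, the $\lambda$-parallel polygon $P(\lambda)$ has vertices $P_i(\lambda)=P_i+\lambda\mathbf{n}_i$ and edges $\mathbf{v}_{i+\frac12}(\lambda)$ from $P_i(\lambda)$ to $P_{i+1}(\lambda)$. The normal line at $P_i$ is $\{P_i(\lambda):\lambda\in\mathbb{R}\}$. Affine evolute: the node $Q_{i+\frac12}$ is the intersection of the normal lines at $P_i$ and $P_{i+1}$, so $Q_{i+\frac12}=P_i+\frac1{\mu_{i+\frac12}}\mathbf{n}_i=P_{i+1}+\frac1{\mu_{i+\frac12}}\mathbf{n}_{i+1}$.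 The edge $\mathbf{e}_i$ is the subset of the normal line at $P_i$ with boundary $\{Q_{i-\frac12},Q_{i+\frac12}\}$ that does not contain $P_i$: the segment $\overline{Q_{i-\frac12}Q_{i+\frac12}}$ if $\mu_{i-\frac12}\mu_{i+\frac12}>0$, the complement of this segment if $\mu_{i-\frac12}\mu_{i+\frac12}<0$, and a half-line if $\mu_{i-\frac12}$ or $\mu_{i+\frac12}$ is zero. The affine evolute is the graph with nodes $Q_{i+\frac12}$ and edges $\mathbf{e}_i$; each $\mathbf{e}_i$ is given the orientation of $\mathbf{n}_i$. A cusp of the affine evolute is a node $Q_{i+\frac12}$ whose adjacent pair of edges $\mathbf{e}_i,\mathbf{e}_{i+1}$ is not coherently oriented. Affine distance symmetry set (ADSS): the closure of the set of points $X$ such that there exist two edges $\mathbf{v}_{i+\frac12}$ and $\mathbf{v}_{j+\frac12}$, $|i-j|\ge2$, and $\lambda\in\mathbb{R}$ such that the edges $\mathbf{v}_{i+\frac12}(\lambda)$ and $\mathbf{v}_{j+\frac12}(\lambda)$ of $P(\lambda)$ intersect at $X$. The points of the ADSS associated with the edges $\mathbf{v}_{i+\frac12}$ and $\mathbf{v}_{j+\frac12}$ are denoted $\mathbf{h}(i+\frac12,j+\frac12)$; this is a segment with endpoints on the normal lines at $P_i,P_{i+1},P_j$ or $P_{j+1}$, and these segments are the edges of the ADSS. A node $M$ of the ADSS belongs to a normal line at some vertex $P_i$; either it is a common vertex of $\mathbf{h}(i-\frac12,j+\frac12)$ and $\mathbf{h}(i+\frac12,j+\frac12)$, or it is connected to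 only one edge $\mathbf{h}(i-\frac12,i+\frac32)$. In the latter case it is denoted $M_{i+\frac12}$ and called an endpoint of the ADSS. The point $M_{i+\frac12}$ is located at the intersection $Q_{i+\frac12}$ of the normal lines at $P_i$ and $P_{i+1}$. *)

theory Defs
  imports "HOL-Analysis.Analysis"
begin

text \<open>
  An \<open>n\<close>-gon is a vertex sequence \<open>P :: int \<Rightarrow> real^2\<close> of period \<open>n\<close>. A half-integer index
  \<open>i + 1/2\<close> is represented by the integer \<open>i\<close>: \<open>side_vec P i\<close> is the side from \<open>P i\<close> to
  \<open>P (i + 1)\<close>, \<open>curvature P i\<close> is its curvature, \<open>evolute_node P i\<close> is the evolute node with
  index \<open>i + 1/2\<close>, and so on.
\<close>

definition bracket :: "real^2 \<Rightarrow> real^2 \<Rightarrow> real" where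
  "bracket u v = det (vector [u, v] :: real^2^2)"

definition side_vec :: "(int \<Rightarrow> real^2) \<Rightarrow> int \<Rightarrow> real^2" where
  "side_vec P i = P (i + 1) - P i"

definition side :: "(int \<Rightarrow> real^2) \<Rightarrow> int \<Rightarrow> (real^2) set" where
  "side P i = closed_segment (P i) (P (i + 1))"

text \<open>The condition \<open>\<bar>i - j\<bar> \<ge> 2\<close>, with indices read modulo \<open>n\<close>.\<close>

definition nonadjacent :: "nat \<Rightarrow> int \<Rightarrow> int \<Rightarrow> bool" where
  "nonadjacent n i j \<longleftrightarrow> 2 \<le> (i - j) mod int n \<and> 2 \<le> (j - i) mod int n"

definition simple_polygon :: "nat \<Rightarrow> (int \<Rightarrow> real^2) \<Rightarrow> bool" where
  "simple_polygon n P \<longleftrightarrow>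
     (\<forall>i. P (i + int n) = P i) \<and>
     (\<forall>i. P i \<noteq> P (i + 1)) \<and>
     (\<forall>i. side P i \<inter> side P (i + 1) = {P (i + 1)}) \<and>
     (\<forall>i j. nonadjacent n i j \<longrightarrow> side P i \<inter> side P j = {})"

definition bounds_convex_domain :: "(int \<Rightarrow> real^2) \<Rightarrow> bool" where
  "bounds_convex_domain P \<longleftrightarrow>
     (\<exists>D. open D \<and> convex D \<and> bounded D \<and> D \<noteq> {} \<and> frontier D = (\<Union>i. side P i))"

text \<open>
  The common value of the determinants is not normalized to 1: none of the notions below
  depends on the normalization, up to a rescaling of the parameter of the parallel polygons.
\<close>

definition convex_equal_area_polygon :: "nat \<Rightarrow> (int \<Rightarrow> real^2) \<Rightarrow> bool" where
  "convex_equal_area_polygon n P \<longleftrightarrow>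
     5 \<le> n \<and> simple_polygon n P \<and> bounds_convex_domain P \<and>
     (\<forall>i. bracket (side_vec P (i - 1)) (side_vec P i)
        = bracket (side_vec P i) (side_vec P (i + 1)))"

definition affine_normal :: "(int \<Rightarrow> real^2) \<Rightarrow> int \<Rightarrow> real^2" where
  "affine_normal P i = side_vec P i - side_vec P (i - 1)"

definition curvature :: "(int \<Rightarrow> real^2) \<Rightarrow> int \<Rightarrow> real" where
  "curvature P i =
     (THE m. affine_normal P (i + 1) - affine_normal P i = - m *\<^sub>R side_vec P i)"

definition parallel_polygon :: "(int \<Rightarrow> real^2) \<Rightarrow> real \<Rightarrow> int \<Rightarrow> real^2" where
  "parallel_polygon P l i = P i + l *\<^sub>R affine_normal P i"

definition normal_line :: "(int \<Rightarrow> real^2) \<Rightarrow> int \<Rightarrow> (real^2) set" where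
  "normal_line P i = range (\<lambda>l. parallel_polygon P l i)"

text \<open>Meaningful only if \<open>curvature P i \<noteq> 0\<close>; otherwise the two normal lines are parallel.\<close>

definition evolute_node :: "(int \<Rightarrow> real^2) \<Rightarrow> int \<Rightarrow> real^2" where
  "evolute_node P i = (THE Q. normal_line P i \<inter> normal_line P (i + 1) = {Q})"

text \<open>If exactly one of the two curvatures vanishes, the edge is the half-line that starts at
  the only finite node and points away from \<open>P i\<close>. If both vanish, there is no finite node
  and the edge is empty.\<close>

definition evolute_edge :: "(int \<Rightarrow> real^2) \<Rightarrow> int \<Rightarrow> (real^2) set" where
  "evolute_edge P i =
     (let a = curvature P (i - 1); b = curvature P i;
          A = evolute_node P (i - 1); B = evolute_node P i
      in if a * b > 0 then closed_segment A B
         else if a * b < 0 then normal_line P i - closed_segment A B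
         else if b \<noteq> 0 then {B + t *\<^sub>R (B - P i) | t. 0 \<le> t}
         else if a \<noteq> 0 then {A + t *\<^sub>R (A - P i) | t. 0 \<le> t}
         else {})"

definition arrives_at :: "(real^2) set \<Rightarrow> real^2 \<Rightarrow> real^2 \<Rightarrow> bool" where
  "arrives_at e d Q \<longleftrightarrow> (\<forall>\<^sub>F t in at_right (0::real). Q - t *\<^sub>R d \<in> e)"

definition leaves_from :: "(real^2) set \<Rightarrow> real^2 \<Rightarrow> real^2 \<Rightarrow> bool" where
  "leaves_from e d Q \<longleftrightarrow> (\<forall>\<^sub>F t in at_right (0::real). Q + t *\<^sub>R d \<in> e)"

definition coherently_oriented :: "(int \<Rightarrow> real^2) \<Rightarrow> int \<Rightarrow> real^2 \<Rightarrow> bool" where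
  "coherently_oriented P i Q \<longleftrightarrow>
     arrives_at (evolute_edge P i) (affine_normal P i) Q \<and>
     leaves_from (evolute_edge P (i + 1)) (affine_normal P (i + 1)) Q
   \<or> leaves_from (evolute_edge P i) (affine_normal P i) Q \<and>
     arrives_at (evolute_edge P (i + 1)) (affine_normal P (i + 1)) Q"

text \<open>If two consecutive curvatures coincide, the evolute edge between their nodes collapses to
  a point and carries no orientation; a node of such an edge is not counted as a cusp.\<close>

definition evolute_cusp :: "(int \<Rightarrow> real^2) \<Rightarrow> int \<Rightarrow> real^2 \<Rightarrow> bool" where
  "evolute_cusp P i Q \<longleftrightarrow>
     curvature P i \<noteq> 0 \<and> Q = evolute_node P i \<and>
     evolute_edge P i \<noteq> {Q} \<and> evolute_edge P (i + 1) \<noteq> {Q} \<and>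
     \<not> coherently_oriented P i Q"

definition adss_points :: "(int \<Rightarrow> real^2) \<Rightarrow> int \<Rightarrow> int \<Rightarrow> (real^2) set" where
  "adss_points P i j =
     (\<Union>l. side (parallel_polygon P l) i \<inter> side (parallel_polygon P l) j)"

definition adss :: "nat \<Rightarrow> (int \<Rightarrow> real^2) \<Rightarrow> (real^2) set" where
  "adss n P = closure (\<Union>{adss_points P i j | i j. nonadjacent n i j})"

definition adss_edge :: "(int \<Rightarrow> real^2) \<Rightarrow> int \<Rightarrow> int \<Rightarrow> (real^2) set" where
  "adss_edge P i j = closure (adss_points P i j)"

text \<open>
  \<open>M\<close> is an end vertex of the straight edge \<open>h\<close>. The condition is local at \<open>M\<close> because, like
  an evolute edge, \<open>h\<close> may pass through infinity, i.e. consist of two half-lines of one line.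
  It fails if \<open>h\<close> is just the point \<open>M\<close>: the sides with indices \<open>i - 1\<close> and \<open>i + 1\<close> of the
  parallel polygon always meet at \<open>evolute_node P i\<close> (if it exists), where the vertices
  \<open>i\<close> and \<open>i + 1\<close> come together, but this point alone is not an edge.
\<close>

definition end_vertex :: "(real^2) set \<Rightarrow> real^2 \<Rightarrow> bool" where
  "end_vertex h M \<longleftrightarrow>
     M \<in> h \<and> M islimpt h \<and> (\<exists>r>0. M extreme_point_of (h \<inter> ball M r))"

text \<open>
  A node on the normal line at \<open>P i\<close> arises where the vertex \<open>i\<close> of some parallel polygon hits
  a side \<open>j\<close> not adjacent to that vertex. It is connected to the edges
  \<open>adss_edge P (i - 1) j\<close> and \<open>adss_edge P i j\<close>, as far as their indices are not adjacent.
  A node is thus identified by the indices that produce it, not just by its position;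
  unrelated pieces of the ADSS may run through the same point of the plane.
\<close>

definition adss_node :: "nat \<Rightarrow> (int \<Rightarrow> real^2) \<Rightarrow> int \<Rightarrow> int \<Rightarrow> real^2 \<Rightarrow> bool" where
  "adss_node n P i j M \<longleftrightarrow>
     M \<in> adss n P \<and> \<not> int n dvd j - i \<and> \<not> int n dvd j - (i - 1) \<and>
     (\<exists>l. M = parallel_polygon P l i \<and> M \<in> side (parallel_polygon P l) j)"

definition connected_edges ::
  "nat \<Rightarrow> (int \<Rightarrow> real^2) \<Rightarrow> int \<Rightarrow> int \<Rightarrow> real^2 \<Rightarrow> (int \<times> int) set" where
  "connected_edges n P i j M =
     {(k, j) | k. k \<in> {i - 1, i} \<and> nonadjacent n k j \<and> end_vertex (adss_edge P k j) M}"

definition adss_endpoint :: "nat \<Rightarrow> (int \<Rightarrow> real^2) \<Rightarrow> int \<Rightarrow> real^2 \<Rightarrow> bool" where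
  "adss_endpoint n P i M \<longleftrightarrow>
     adss_node n P i (i + 1) M \<and> connected_edges n P i (i + 1) M = {(i - 1, i + 1)}"

end

theory Submission
  imports Defs
begin

text \<open>
  Write \<open>a\<close>, \<open>b\<close>, \<open>d\<close> for the curvatures of the sides \<open>i - 1\<close>, \<open>i\<close>, \<open>i + 1\<close>. Both properties
  force \<open>b \<noteq> 0\<close> and \<open>M\<close> to be the evolute node, and both then amount to \<open>(b - a) (b - d) > 0\<close>.
  On the evolute side, with the parameter \<open>\<lambda>\<close> on the normal line, the edge \<open>e\<^sub>i\<close> is where
  \<open>(1 - \<lambda> a) (1 - \<lambda> b) \<le> 0\<close> up to end points, so it leaves the node \<open>\<lambda> = 1/b\<close> if \<open>b > a\<close>
  and arrives there if \<open>b < a\<close>; likewise for \<open>e\<^sub>i\<^sub>+\<^sub>1\<close> with \<open>d\<close>. On the ADSS side, the sides of the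
  parallel polygon keep their directions, so for \<open>\<lambda> = 1/b + t\<close> the lines of the sides \<open>i - 1\<close>
  and \<open>i + 1\<close> meet in a point that moves affinely in \<open>t\<close>. For small \<open>t \<noteq> 0\<close> it lies on both
  sides iff \<open>t (b - a) > 0\<close> and \<open>t (b - d) > 0\<close>, provided \<open>b < 2\<close>, which is where convexity
  and \<open>n \<ge> 5\<close> enter.
\<close>

section \<open>Determinants of plane vectors\<close>

lemma bracket_eq: "bracket u v = u $ 1 * v $ 2 - u $ 2 * v $ 1"
  by (simp add: bracket_def det_2)

lemma bracket_self [simp]: "bracket u u = 0"
  by (simp add: bracket_eq)

lemma bracket_swap: "bracket v u = - bracket u v"
  by (simp add: bracket_eq)

lemma bracket_add_left: "bracket (u + v) w = bracket u w + bracket v w"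
  by (simp add: bracket_eq algebra_simps)

lemma bracket_add_right: "bracket u (v + w) = bracket u v + bracket u w"
  by (simp add: bracket_eq algebra_simps)

lemma bracket_diff_left: "bracket (u - v) w = bracket u w - bracket v w"
  by (simp add: bracket_eq algebra_simps)

lemma bracket_diff_right: "bracket u (v - w) = bracket u v - bracket u w"
  by (simp add: bracket_eq algebra_simps)

lemma bracket_scaleR_left: "bracket (k *\<^sub>R u) v = k * bracket u v"
  by (simp add: bracket_eq algebra_simps)

lemma bracket_scaleR_right: "bracket u (k *\<^sub>R v) = k * bracket u v"
  by (simp add: bracket_eq algebra_simps)

lemmas bracket_simps = bracket_add_left bracket_add_right bracket_diff_left bracket_diff_right
  bracket_scaleR_left bracket_scaleR_right

lemma parallel_if_bracket_zero:
  assumes "bracket u v = 0" and "u \<noteq> 0"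
  obtains k where "v = k *\<^sub>R u"
proof (cases "u $ 1 = 0")
  case True
  then have "u $ 2 \<noteq> 0" using \<open>u \<noteq> 0\<close> by (auto simp: vec_eq_iff forall_2)
  with True assms(1) have "v = (v $ 2 / u $ 2) *\<^sub>R u"
    by (auto simp: vec_eq_iff forall_2 bracket_eq)
  then show ?thesis ..
next
  case False
  with assms(1) have "v = (v $ 1 / u $ 1) *\<^sub>R u"
    by (auto simp: vec_eq_iff forall_2 bracket_eq field_simps)
  then show ?thesis ..
qed

lemma independent_if_bracket_nonzero:
  assumes "bracket u v \<noteq> 0" and "s *\<^sub>R u + t *\<^sub>R v = 0"
  shows "s = 0 \<and> t = 0"
proof -
  have "bracket (s *\<^sub>R u + t *\<^sub>R v) v = 0" "bracket u (s *\<^sub>R u + t *\<^sub>R v) = 0"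
    using assms(2) by (simp_all add: bracket_eq)
  then show ?thesis
    using assms(1) by (simp add: bracket_simps)
qed

section \<open>Consequences of simplicity and convexity\<close>

lemma side_alt: "side P i = {P i + t *\<^sub>R side_vec P i | t. 0 \<le> t \<and> t \<le> 1}"
proof -
  have "(1 - t) *\<^sub>R P i + t *\<^sub>R P (i + 1) = P i + t *\<^sub>R side_vec P i" for t
    by (simp add: side_vec_def algebra_simps)
  then show ?thesis
    by (simp add: side_def closed_segment_def)
qed

lemma vertex_in_side: "P i \<in> side P i" "P (i + 1) \<in> side P i"
  by (simp_all add: side_def)

text \<open>A supporting line of the domain through the midpoint of a side must contain the whole
  side, and all vertices lie in one of its closed half-planes.\<close>

lemma bracket_same_side:
  assumes "bounds_convex_domain P" and "side_vec P i \<noteq> 0"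
  shows "0 \<le> bracket (side_vec P i) (P j - P i) * bracket (side_vec P i) (P k - P i)"
proof -
  obtain D where D: "open D" "convex D" "frontier D = (\<Union>i. side P i)"
    using assms(1) unfolding bounds_convex_domain_def by blast
  define v where "v = side_vec P i"
  define m where "m = midpoint (P i) (P (i + 1))"
  have fr: "P j \<in> closure D" for j
    using D(3) vertex_in_side(1)[of P j] by (auto simp: frontier_def)
  have "m \<in> frontier D"
    unfolding D(3) m_def side_def by (auto intro: exI[of _ i])
  then have "m \<in> closure D" "m \<notin> D"
    using D(1) by (auto simp: frontier_def interior_open)
  then have "m \<notin> rel_interior (closure D)"
    using D(1,2) by (simp add: convex_rel_interior_closure rel_interior_open)
  then obtain a where "a \<noteq> 0" and a: "\<And>y. y \<in> closure D \<Longrightarrow> a \<bullet> m \<le> a \<bullet> y"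
    using supporting_hyperplane_rel_boundary[OF convex_closure[OF D(2)] \<open>m \<in> closure D\<close>]
    by metis
  have am: "a \<bullet> m = (a \<bullet> P i + a \<bullet> P (i + 1)) / 2"
    by (simp add: m_def midpoint_def inner_add_right)
  \<comment> \<open>Both values are at least \<open>a \<bullet> m\<close> and their mean is
    \<open>a \<bullet> m\<close>.\<close>
  then have eq: "a \<bullet> P i = a \<bullet> m" "a \<bullet> P (i + 1) = a \<bullet> m"
    using a[OF fr, of i] a[OF fr, of "i + 1"] by (simp_all add: field_simps)
  then have av: "a \<bullet> v = 0"
    by (simp add: v_def side_vec_def inner_diff_right)
  \<comment> \<open>Since \<open>a\<close> is orthogonal to \<open>v\<close>, this planar identity
    turns the half-plane condition on inner products into one on brackets. At \<open>x = a\<close>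
    it shows that \<open>bracket v a\<close> is nonzero.\<close>
  have id: "(a \<bullet> x) * (v \<bullet> v) = bracket v a * bracket v x" for x
  proof -
    have "(a \<bullet> x) * (v \<bullet> v) = (a \<bullet> v) * (v \<bullet> x) + bracket v a * bracket v x"
      by (simp add: inner_vec_def sum_2 bracket_eq algebra_simps)
    then show ?thesis using av by simp
  qed
  have nn: "0 \<le> bracket v a * bracket v (P j - P i)" for j
  proof -
    have "0 \<le> a \<bullet> (P j - P i)" using a[OF fr, of j] eq by (simp add: inner_diff_right)
    then show ?thesis unfolding id[symmetric] by simp
  qed
  have "bracket v a * bracket v a > 0"
    unfolding id[symmetric] using \<open>a \<noteq> 0\<close> assms(2) by (simp add: v_def)
  moreover have "0 \<le> (bracket v a * bracket v a) * (bracket v (P j - P i) * bracket v (P k - P i))"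
    using mult_nonneg_nonneg[OF nn[of j] nn[of k]] by (simp add: ac_simps)
  ultimately show ?thesis unfolding v_def[symmetric] by (simp add: zero_le_mult_iff)
qed

text \<open>With opposite directions the second side would fold back over the first, and the two
  would share more than their common vertex.\<close>

lemma consecutive_sides_same_direction:
  assumes "simple_polygon n P" and "bracket (side_vec P i) (side_vec P (i + 1)) = 0"
  obtains k where "k > 0" and "side_vec P (i + 1) = k *\<^sub>R side_vec P i"
proof -
  have nz: "side_vec P j \<noteq> 0" for j
    using assms(1) by (simp add: simple_polygon_def side_vec_def) (metis)
  obtain k where k: "side_vec P (i + 1) = k *\<^sub>R side_vec P i"
    using parallel_if_bracket_zero assms(2) nz by blast
  have "k \<noteq> 0" using k nz[of "i + 1"] by auto
  moreover have False if "k < 0"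
  proof -
    \<comment> \<open>Going back from \<open>P (i + 1)\<close> by \<open>s\<close> times the side
      vector stays on side \<open>i\<close> because \<open>s \<le> 1\<close>, and on side
      \<open>i + 1\<close> because \<open>s \<le> - k\<close>.\<close>
    define s where "s = min 1 (- k)"
    have s: "0 < s" "s \<le> 1" "s \<le> - k" using that by (auto simp: s_def)
    define X where "X = P (i + 1) - s *\<^sub>R side_vec P i"
    have "X = P i + (1 - s) *\<^sub>R side_vec P i"
      by (simp add: X_def side_vec_def algebra_simps)
    then have "X \<in> side P i" unfolding side_alt using s by force
    moreover have "X = P (i + 1) + (s / (- k)) *\<^sub>R side_vec P (i + 1)"
      using that by (simp add: X_def k)
    moreover have "0 \<le> s / (- k)" "s / (- k) \<le> 1" using s that by (auto simp: field_simps)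
    ultimately have "X \<in> side P i \<inter> side P (i + 1)" unfolding side_alt[of P "i + 1"] by blast
    moreover have "side P i \<inter> side P (i + 1) = {P (i + 1)}"
      using assms(1) by (simp add: simple_polygon_def)
    ultimately have "X = P (i + 1)" by simp
    then show False using s nz by (simp add: X_def)
  qed
  ultimately have "k > 0" by (metis linorder_neqE)
  then show ?thesis using that k by blast
qed

text \<open>For \<open>c = 0\<close> all sides from index 0 on are positive multiples of side 0, so
  the polygon moves steadily away from \<open>P 0\<close> and cannot close up after \<open>n\<close>
  steps.\<close>

lemma bracket_nonzero_if_constant:
  assumes "5 \<le> n" and simple: "simple_polygon n P"
    and c: "\<And>i. bracket (side_vec P i) (side_vec P (i + 1)) = c"
  shows "c \<noteq> 0"
proof
  assume "c = 0"
  then have step: "\<exists>k>0. side_vec P (i + 1) = k *\<^sub>R side_vec P i" for i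
    using consecutive_sides_same_direction[OF simple] c by metis
  have dir: "\<exists>k>0. side_vec P (int m) = k *\<^sub>R side_vec P 0" for m
  proof (induction m)
    case 0
    show ?case by (rule exI[of _ 1]) simp
  next
    case (Suc m)
    then obtain k l where "k > 0" "side_vec P (int m) = k *\<^sub>R side_vec P 0"
      "l > 0" "side_vec P (int m + 1) = l *\<^sub>R side_vec P (int m)"
      using step by blast
    then show ?case by (intro exI[of _ "l * k"]) (simp add: add.commute)
  qed
  have "\<exists>k>0. P (int (Suc m)) - P 0 = k *\<^sub>R side_vec P 0" for m
  proof (induction m)
    case 0
    show ?case by (rule exI[of _ 1]) (simp add: side_vec_def)
  next
    case (Suc m)
    then obtain k l where "k > 0" "P (int (Suc m)) - P 0 = k *\<^sub>R side_vec P 0"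
      "l > 0" "side_vec P (int (Suc m)) = l *\<^sub>R side_vec P 0"
      using dir by blast
    then show ?case
      by (intro exI[of _ "k + l"]) (simp add: side_vec_def algebra_simps)
  qed
  from this[of "n - 1"] obtain k where "k > 0" "P (int n) - P 0 = k *\<^sub>R side_vec P 0"
    using \<open>5 \<le> n\<close> by auto
  moreover have "P (0 + int n) = P 0" "P 0 \<noteq> P (0 + 1)"
    using simple unfolding simple_polygon_def by blast+
  ultimately show False by (simp add: side_vec_def)
qed

text \<open>If \<open>P j\<close> lay on the line of side \<open>i\<close> outside that side, then the line of one of the two
  adjacent sides would separate \<open>P j\<close> from the far end of side \<open>i\<close>.\<close>

lemma bracket_nonzero_off_side:
  assumes convex: "bounds_convex_domain P"
    and c: "\<And>i. bracket (side_vec P (i - 1)) (side_vec P i) = c" and "c \<noteq> 0"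
    and off: "P j \<notin> side P i"
  shows "bracket (side_vec P i) (P j - P i) \<noteq> 0"
proof
  have nz: "side_vec P k \<noteq> 0" for k
    using c[of k] \<open>c \<noteq> 0\<close> by (auto simp: bracket_eq)
  assume "bracket (side_vec P i) (P j - P i) = 0"
  then obtain t where t: "P j - P i = t *\<^sub>R side_vec P i"
    using parallel_if_bracket_zero nz by blast
  then have Pj: "P j = P i + t *\<^sub>R side_vec P i" by (simp add: algebra_simps)
  then have "t < 0 \<or> t > 1" using off unfolding side_alt by (force simp: not_less[symmetric])
  then show False
  proof
    \<comment> \<open>Over the line of side \<open>i - 1\<close>, the vertices
      \<open>P (i + 1)\<close> and \<open>P j\<close> have heights \<open>c\<close> and
      \<open>t * c\<close>, of opposite signs.\<close>
    assume "t < 0"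
    have "P (i + 1) - P (i - 1) = side_vec P (i - 1) + side_vec P i"
      "P j - P (i - 1) = side_vec P (i - 1) + t *\<^sub>R side_vec P i"
      using Pj by (simp_all add: side_vec_def)
    then have "0 \<le> c * (t * c)"
      using bracket_same_side[OF convex nz, of "i - 1" "i + 1" j] c[of i]
      by (simp add: bracket_simps)
    then have "0 \<le> t * (c * c)" by (simp add: ac_simps)
    moreover have "t * (c * c) < 0" using \<open>t < 0\<close> \<open>c \<noteq> 0\<close>
      by (intro mult_neg_pos) (auto simp: zero_less_mult_iff neq_iff)
    ultimately show False by simp
  next
    \<comment> \<open>Mirror image: over the line of side \<open>i + 1\<close>, the vertices
      \<open>P i\<close> and \<open>P j\<close> have heights \<open>c\<close> and
      \<open>(1 - t) * c\<close>.\<close>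
    assume "t > 1"
    have "P i - P (i + 1) = - 1 *\<^sub>R side_vec P i" by (simp add: side_vec_def)
    moreover have "P j - P (i + 1) = (t - 1) *\<^sub>R side_vec P i"
      using Pj by (simp add: side_vec_def algebra_simps)
    ultimately have "0 \<le> (- 1 * - c) * ((t - 1) * - c)"
      using bracket_same_side[OF convex nz, of "i + 1" i j] c[of "i + 1"]
        bracket_swap[of "side_vec P (i + 1)" "side_vec P i"]
      by (simp only: bracket_scaleR_right) simp
    moreover have "(1 - t) * (c * c) < 0" using \<open>t > 1\<close> \<open>c \<noteq> 0\<close>
      by (intro mult_neg_pos) (auto simp: zero_less_mult_iff neq_iff)
    ultimately show False by (simp add: algebra_simps)
  qed
qed

section \<open>Sides, normals and curvature of an equal-area polygon\<close>

locale equal_area_vertices =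
  fixes P :: "int \<Rightarrow> real^2" and c :: real
  assumes bracket_consecutive: "bracket (side_vec P (i - 1)) (side_vec P i) = c"
    and c_nonzero: "c \<noteq> 0"
begin

lemma side_vec_nonzero: "side_vec P i \<noteq> 0"
  using bracket_consecutive[of i] c_nonzero by (auto simp: bracket_eq)

text \<open>The equal determinants cancel in the bracket of the difference with side
  \<open>i\<close>, so the difference is a multiple of that side. Its factor is unique because the
  side is nonzero, which makes the description in \<open>curvature\<close> well defined.\<close>

lemma affine_normal_diff:
  "affine_normal P (i + 1) - affine_normal P i = - curvature P i *\<^sub>R side_vec P i"
proof -
  have "bracket (side_vec P i) (affine_normal P (i + 1) - affine_normal P i) = 0"
    using bracket_consecutive[of i] bracket_consecutive[of "i + 1"]
      bracket_swap[of "side_vec P i" "side_vec P (i - 1)"]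
    by (simp only: affine_normal_def bracket_simps) simp
  then obtain k where "affine_normal P (i + 1) - affine_normal P i = k *\<^sub>R side_vec P i"
    using parallel_if_bracket_zero side_vec_nonzero by blast
  then have "affine_normal P (i + 1) - affine_normal P i = - (- k) *\<^sub>R side_vec P i" by simp
  then show ?thesis
    unfolding curvature_def
  proof (rule theI)
    fix m assume "affine_normal P (i + 1) - affine_normal P i = - m *\<^sub>R side_vec P i"
    then have "- m *\<^sub>R side_vec P i = - (- k) *\<^sub>R side_vec P i"
      using \<open>affine_normal P (i + 1) - affine_normal P i = - (- k) *\<^sub>R side_vec P i\<close> by simp
    then have "- m = - (- k)" using side_vec_nonzero by (metis scaleR_cancel_right)
    then show "m = - k" by simp
  qed
qed

text \<open>Three-term recurrence that expresses later sides in the basis of sides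
  \<open>i - 1\<close> and \<open>i\<close>, whose determinant is \<open>c\<close>.\<close>

lemma side_vec_next:
  "side_vec P (i + 1) = (2 - curvature P i) *\<^sub>R side_vec P i - side_vec P (i - 1)"
  using affine_normal_diff[of i] by (simp add: affine_normal_def algebra_simps scaleR_2)

lemma affine_normal_next:
  "affine_normal P (i + 1) = affine_normal P i - curvature P i *\<^sub>R side_vec P i"
  using affine_normal_diff[of i] by (simp add: algebra_simps)

lemma affine_normal_nonzero: "affine_normal P i \<noteq> 0"
proof -
  have "bracket (side_vec P (i - 1)) (affine_normal P i) = c"
    using bracket_consecutive[of i] by (simp add: affine_normal_def bracket_simps)
  then show ?thesis using c_nonzero by (auto simp: bracket_eq)
qed

text \<open>The vertices \<open>i + 2\<close> and \<open>i + 3\<close> lie at heights \<open>(3 - \<mu>\<^sub>i) c\<close> and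
  \<open>(2 - \<mu>\<^sub>i) (3 - \<mu>\<^sub>i\<^sub>+\<^sub>1) c\<close> over the line of side \<open>i - 1\<close>. For \<open>n \<ge> 5\<close>
  both heights have the sign of \<open>c\<close>.\<close>

lemma curvature_less_2:
  assumes "5 \<le> n" and simple: "simple_polygon n P" and convex: "bounds_convex_domain P"
  shows "curvature P i < 2"
proof -
  have height2: "bracket (side_vec P (i - 1)) (P (i + 2) - P (i - 1)) = (3 - curvature P i) * c" for i
  proof -
    have "P (i + 2) - P (i - 1) = side_vec P (i - 1) + side_vec P i + side_vec P (i + 1)"
      by (simp add: side_vec_def add.commute)
    then show ?thesis unfolding side_vec_next[of i]
      by (simp only: bracket_simps bracket_consecutive bracket_self) (simp add: algebra_simps)
  qed
  have height3: "bracket (side_vec P (i - 1)) (P (i + 3) - P (i - 1))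
      = (2 - curvature P i) * (3 - curvature P (i + 1)) * c"
  proof -
    have "P (i + 3) - P (i - 1)
        = side_vec P (i - 1) + side_vec P i + side_vec P (i + 1) + side_vec P (i + 1 + 1)"
      by (simp add: side_vec_def add.commute)
    then show ?thesis unfolding side_vec_next[of "i + 1"] add_diff_cancel_right' side_vec_next[of i]
      by (simp only: bracket_simps bracket_consecutive bracket_self) (simp add: algebra_simps)
  qed
  have pos: "0 < bracket (side_vec P (i - 1)) (P j - P (i - 1)) * c"
    if "j \<in> {i + 2, i + 3}" for i j
  proof -
    \<comment> \<open>The indices differ by 3 and, the other way round, by \<open>n - 3\<close>,
      which is at least 2. The two vertices in question are the ends of side
      \<open>i + 2\<close>.\<close>
    have "nonadjacent n (i - 1) (i + 2)"
      using \<open>5 \<le> n\<close> zmod_zminus1_eq_if[of 3 "int n"] by (simp add: nonadjacent_def)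
    then have "side P (i - 1) \<inter> side P (i + 2) = {}"
      using simple by (simp add: simple_polygon_def)
    moreover have "P j \<in> side P (i + 2)"
      using that vertex_in_side[of P "i + 2"] by (auto simp: add.commute)
    ultimately have "P j \<notin> side P (i - 1)" by blast
    then have "bracket (side_vec P (i - 1)) (P j - P (i - 1)) \<noteq> 0"
      using bracket_nonzero_off_side[OF convex bracket_consecutive c_nonzero] by blast
    \<comment> \<open>The vertex \<open>P (i + 1)\<close>, at height \<open>c\<close>, is the
      reference that fixes the sign for all other vertices.\<close>
    moreover have "bracket (side_vec P (i - 1)) (P (i + 1) - P (i - 1)) = c"
    proof -
      have "P (i + 1) - P (i - 1) = side_vec P (i - 1) + side_vec P i"
        by (simp add: side_vec_def)
      then show ?thesis using bracket_consecutive[of i] by (simp add: bracket_simps)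
    qed
    ultimately show ?thesis
      using bracket_same_side[OF convex side_vec_nonzero, of "i - 1" j "i + 1"] c_nonzero
      by (simp add: less_le)
  qed
  have less_3: "curvature P i < 3" for i
  proof -
    have "0 < (3 - curvature P i) * (c * c)"
      using pos[of "i + 2" i] height2[of i] by (simp add: mult.assoc)
    then show ?thesis using c_nonzero by (simp add: zero_less_mult_iff)
  qed
  \<comment> \<open>The second factor is positive by \<open>less_3\<close> at \<open>i + 1\<close>,
    hence so is the first.\<close>
  have "0 < (2 - curvature P i) * (3 - curvature P (i + 1)) * (c * c)"
    using pos[of "i + 3" i] height3 by (simp add: mult.assoc)
  then have "0 < (2 - curvature P i) * (3 - curvature P (i + 1))"
    using c_nonzero by (simp add: zero_less_mult_iff)
  then show ?thesis
    using less_3[of "i + 1"] by (simp add: zero_less_mult_iff)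
qed

end

section \<open>Signs and end points on a line near a node\<close>

lemma eventually_at_right_0_lessI:
  assumes "0 < (d::real)" and "\<And>t. 0 < t \<Longrightarrow> t < d \<Longrightarrow> Q t"
  shows "\<forall>\<^sub>F t in at_right 0. Q t"
  using assms eventually_at_right_field by blast

text \<open>The second factor is \<open>- t * b\<close>, so the product is
  \<open>t * (t * (a * b) - (b - a))\<close>. For small positive \<open>t\<close> it has the sign of
  \<open>a - b\<close>; for \<open>a = b\<close> it is the square of \<open>t * b\<close>.\<close>

lemma edge_product_sign:
  fixes a b :: real
  assumes "b \<noteq> 0"
  shows "b > a \<Longrightarrow> \<forall>\<^sub>F t in at_right 0. (1 - (1 / b + t) * a) * (1 - (1 / b + t) * b) < 0"
    and "b \<le> a \<Longrightarrow> \<forall>\<^sub>F t in at_right 0. 0 < (1 - (1 / b + t) * a) * (1 - (1 / b + t) * b)"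
proof -
  \<comment> \<open>For \<open>t\<close> below this bound the term \<open>t * (a * b)\<close> cannot
    outweigh \<open>b - a\<close>; the summand 1 avoids a division by zero when
    \<open>a = 0\<close>.\<close>
  define D where "D = \<bar>b - a\<bar> / (\<bar>a * b\<bar> + 1)"
  have prod: "(1 - (1 / b + t) * a) * (1 - (1 / b + t) * b) = t * (t * (a * b) - (b - a))" for t
    using assms by (simp add: field_simps)
  have small: "\<bar>t * (a * b)\<bar> < \<bar>b - a\<bar>" if "0 < t" "t < D" for t
  proof -
    have "t * (\<bar>a * b\<bar> + 1) < \<bar>b - a\<bar>"
      using that by (simp add: D_def pos_less_divide_eq add_nonneg_pos)
    then show ?thesis using \<open>0 < t\<close> by (simp add: abs_mult algebra_simps)
  qed
  show "\<forall>\<^sub>F t in at_right 0. (1 - (1 / b + t) * a) * (1 - (1 / b + t) * b) < 0" if "b > a"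
  proof (rule eventually_at_right_0_lessI)
    show "0 < D" using that by (simp add: D_def add_nonneg_pos)
    show "(1 - (1 / b + t) * a) * (1 - (1 / b + t) * b) < 0" if "0 < t" "t < D" for t
      unfolding prod using small[OF that] \<open>b > a\<close> \<open>0 < t\<close> by (simp add: mult_less_0_iff)
  qed
  show "\<forall>\<^sub>F t in at_right 0. 0 < (1 - (1 / b + t) * a) * (1 - (1 / b + t) * b)" if "b \<le> a"
  proof (cases "a = b")
    case True
    then show ?thesis unfolding prod
      using assms by (intro eventually_at_right_0_lessI[of 1]) (auto simp: zero_less_mult_iff)
  next
    case False
    show ?thesis
    proof (rule eventually_at_right_0_lessI)
      show "0 < D" using False by (simp add: D_def add_nonneg_pos)
      show "0 < (1 - (1 / b + t) * a) * (1 - (1 / b + t) * b)" if "0 < t" "t < D" for t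
        unfolding prod using small[OF that] \<open>b \<le> a\<close> False \<open>0 < t\<close> by (simp add: zero_less_mult_iff)
    qed
  qed
qed

lemma half_line_extreme_point:
  fixes Q f :: "'a::real_vector"
  assumes "f \<noteq> 0"
  shows "Q extreme_point_of {Q + t *\<^sub>R f | t. 0 \<le> t}"
proof -
  have "Q \<notin> open_segment (Q + s *\<^sub>R f) (Q + t *\<^sub>R f)" if "0 \<le> s" "0 \<le> t" for s t
  proof
    assume *: "Q \<in> open_segment (Q + s *\<^sub>R f) (Q + t *\<^sub>R f)"
    then obtain u where u: "0 < u" "u < 1"
      "Q = (1 - u) *\<^sub>R (Q + s *\<^sub>R f) + u *\<^sub>R (Q + t *\<^sub>R f)"
      by (auto simp: in_segment)
    then have "((1 - u) * s + u * t) *\<^sub>R f = 0" by (simp add: algebra_simps)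
    then have "(1 - u) * s + u * t = 0" using assms by simp
    then have "s = 0" "t = 0"
      using u that by (auto simp: add_nonneg_eq_0_iff)
    then show False using * by simp
  qed
  then show ?thesis
    unfolding extreme_point_of_def by (force intro: exI[of _ 0])
qed

lemma extreme_point_of_subset:
  "x extreme_point_of S \<Longrightarrow> T \<subseteq> S \<Longrightarrow> x \<in> T \<Longrightarrow> x extreme_point_of T"
  unfolding extreme_point_of_def by blast

text \<open>If \<open>p\<close> and \<open>q\<close> have the same strict sign, the set is near
  \<open>Q\<close> a piece of a half-line starting at \<open>Q\<close>. Otherwise \<open>Q\<close>
  is an isolated point of it.\<close>

lemma end_vertex_line_iff:
  fixes Q f :: "real^2"
  assumes "f \<noteq> 0" and "0 \<in> T" and "0 < d"
    and T: "\<And>t. t \<noteq> 0 \<Longrightarrow> \<bar>t\<bar> < d \<Longrightarrow> t \<in> T \<longleftrightarrow> 0 < t * p \<and> 0 < t * q"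
  shows "end_vertex (closure ((\<lambda>t. Q + t *\<^sub>R f) ` T)) Q \<longleftrightarrow> 0 < p * q"
proof -
  define h where "h = (\<lambda>t. Q + t *\<^sub>R f) ` T"
  define r where "r = d * norm f"
  have "r > 0" using assms by (simp add: r_def)
  have in_ball: "Q + t *\<^sub>R f \<in> ball Q r \<longleftrightarrow> \<bar>t\<bar> < d" for t
    using \<open>f \<noteq> 0\<close> by (simp add: r_def dist_norm)
  have Qh: "Q \<in> h" using \<open>0 \<in> T\<close> by (force simp: h_def)
  show ?thesis
    unfolding h_def[symmetric]
  proof
    assume "0 < p * q"
    \<comment> \<open>The direction is reversed if \<open>p < 0\<close>, so that the parameters near
      0 become nonnegative.\<close>
    define g where "g = sgn p *\<^sub>R f"
    have p0: "sgn p \<noteq> 0" "p \<noteq> 0" "q \<noteq> 0" "sgn q = sgn p"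
      using \<open>0 < p * q\<close> by (auto simp: zero_less_mult_iff sgn_if)
    have "g \<noteq> 0" using p0 \<open>f \<noteq> 0\<close> by (simp add: g_def)
    let ?H = "{Q + t *\<^sub>R g | t. 0 \<le> t}"
    have "h \<inter> ball Q r \<subseteq> ?H"
    proof
      fix x assume "x \<in> h \<inter> ball Q r"
      then obtain t where t: "t \<in> T" "x = Q + t *\<^sub>R f" "\<bar>t\<bar> < d"
        using in_ball by (auto simp: h_def)
      then have "t = 0 \<or> 0 < t * p" using T by blast
      then have "0 \<le> t * sgn p" by (auto simp: zero_less_mult_iff sgn_if)
      moreover have "x = Q + (t * sgn p) *\<^sub>R g"
        using t p0 by (simp add: g_def mult_sgn_abs sgn_if)
      ultimately show "x \<in> ?H" by blast
    qed
    moreover have "closed ?H"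
    proof -
      have "?H = (+) Q ` (\<lambda>t. t *\<^sub>R g) ` {0..}" by auto
      moreover have "closed ((\<lambda>t. t *\<^sub>R g) ` {0..})"
        using \<open>g \<noteq> 0\<close>
        by (intro closed_injective_linear_image) (auto simp: inj_on_def linear_scaleR_left)
      ultimately show ?thesis using closed_translation by metis
    qed
    ultimately have "closure (h \<inter> ball Q r) \<subseteq> ?H" by (rule closure_minimal)
    \<comment> \<open>The ball is open and the half-line is closed, so taking the closure adds no
      points on the other side of \<open>Q\<close>.\<close>
    moreover have "closure h \<inter> ball Q r \<subseteq> closure (h \<inter> ball Q r)"
      using open_Int_closure_subset[of "ball Q r" h] by (simp add: Int_commute)
    ultimately have "closure h \<inter> ball Q r \<subseteq> ?H" by blast
    moreover have "Q \<in> closure h \<inter> ball Q r"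
      using Qh \<open>r > 0\<close> closure_subset by auto
    ultimately have "Q extreme_point_of (closure h \<inter> ball Q r)"
      using extreme_point_of_subset half_line_extreme_point[OF \<open>g \<noteq> 0\<close>] by blast
    moreover have "Q islimpt h"
      unfolding islimpt_approachable
    proof (intro allI impI)
      fix e :: real assume "0 < e"
      define t where "t = min (d / 2) (e / (2 * norm f))"
      have t: "0 < t" "t < d" "t * norm f < e"
        using \<open>0 < e\<close> \<open>0 < d\<close> \<open>f \<noteq> 0\<close>
        by (auto simp: t_def min_def field_simps)
      have "t * sgn p \<in> T"
        using T[of "t * sgn p"] t p0 by (auto simp: abs_mult sgn_if zero_less_mult_iff split: if_splits)
      then have "Q + (t * sgn p) *\<^sub>R f \<in> h" unfolding h_def by (rule imageI)
      moreover have "Q + (t * sgn p) *\<^sub>R f \<noteq> Q" using t p0 \<open>f \<noteq> 0\<close> by simp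
      moreover have "dist (Q + (t * sgn p) *\<^sub>R f) Q < e"
        using t p0 by (simp add: dist_norm abs_mult sgn_if)
      ultimately show "\<exists>x'\<in>h. x' \<noteq> Q \<and> dist x' Q < e" by blast
    qed
    then have "Q islimpt closure h" by (simp add: limpt_of_closure)
    ultimately show "end_vertex (closure h) Q"
      unfolding end_vertex_def using Qh closure_subset \<open>r > 0\<close> by blast
  next
    assume "end_vertex (closure h) Q"
    then have "Q islimpt h" by (simp add: end_vertex_def limpt_of_closure)
    then obtain x where "x \<in> h" "x \<noteq> Q" "x \<in> ball Q r"
      using \<open>r > 0\<close> by (auto simp: islimpt_approachable dist_commute)
    then obtain t where "t \<in> T" "t \<noteq> 0" "\<bar>t\<bar> < d"
      using in_ball by (auto simp: h_def)
    then have "0 < t * p" "0 < t * q" using T by blast+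
    then have "0 < (t * t) * (p * q)" by (auto simp: zero_less_mult_iff)
    then show "0 < p * q" by (auto simp: zero_less_mult_iff)
  qed
qed

text \<open>The parameters \<open>t\<close> for which, at \<open>\<lambda> = 1/b + t\<close>, the intersection of the lines through the
  sides \<open>i - 1\<close> and \<open>i + 1\<close> lies on the side with curvature \<open>a\<close>; here \<open>b = \<mu>\<^sub>i\<close>.\<close>

definition hit_parameters :: "real \<Rightarrow> real \<Rightarrow> real set" where
  "hit_parameters b a =
     {t. \<exists>x. 0 \<le> x \<and> x \<le> 1 \<and> x * (1 - (1 / b + t) * a) = b * t / (2 - b)}"

text \<open>After multiplication by \<open>b\<close> the equation is \<open>x * y = w\<close> with
  \<open>y\<close> close to \<open>b - a\<close> and \<open>w\<close> small, of the sign of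
  \<open>t\<close> because \<open>b < 2\<close>. Its solution lies between 0 and 1 exactly if
  \<open>y\<close> and \<open>w\<close> have the same sign.\<close>

lemma hit_parameters_near_0:
  assumes "b \<noteq> 0" and "b < 2"
  obtains d where "0 < d"
    and "\<And>t. t \<noteq> 0 \<Longrightarrow> \<bar>t\<bar> < d \<Longrightarrow> t \<in> hit_parameters b a \<longleftrightarrow> 0 < t * (b - a)"
proof -
  have mem: "t \<in> hit_parameters b a \<longleftrightarrow>
      (\<exists>x. 0 \<le> x \<and> x \<le> 1 \<and> x * (b - a - t * a * b) = b\<^sup>2 * t / (2 - b))" for t
  proof -
    have "x * (1 - (1 / b + t) * a) = b * t / (2 - b) \<longleftrightarrow>
      x * (b - a - t * a * b) = b\<^sup>2 * t / (2 - b)" for x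
    proof -
      have "x * (b - a - t * a * b) = b * (x * (1 - (1 / b + t) * a))"
        using assms(1) by (simp add: field_simps)
      moreover have "b\<^sup>2 * t / (2 - b) = b * (b * t / (2 - b))" by (simp add: power2_eq_square)
      ultimately show ?thesis using assms(1) by (simp only: mult_cancel_left) simp
    qed
    then show ?thesis unfolding hit_parameters_def by blast
  qed
  \<comment> \<open>Chosen so that \<open>\<bar>t\<bar> * K\<close> is the sum of
    \<open>\<bar>t * a * b\<bar>\<close> and \<open>\<bar>w\<bar>\<close>. If this is less than
    \<open>\<bar>b - a\<bar>\<close>, then \<open>y\<close> has the sign of \<open>b - a\<close> and
    \<open>\<bar>w\<bar> \<le> \<bar>y\<bar>\<close>.\<close>
  define K where "K = \<bar>a * b\<bar> + b\<^sup>2 / (2 - b)"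
  have K: "K > 0" using assms by (simp add: K_def add_nonneg_pos)
  show ?thesis
  proof (cases "a = b")
    case True
    \<comment> \<open>For \<open>a = b\<close> the equation forces \<open>x = - 1 / (2 - b)\<close>,
      which is negative.\<close>
    have "t \<notin> hit_parameters b a" if "t \<noteq> 0" for t
    proof
      assume "t \<in> hit_parameters b a"
      then obtain x where "0 \<le> x" "x * (- t * b\<^sup>2) = b\<^sup>2 * t / (2 - b)"
        unfolding mem by (auto simp: True power2_eq_square mult.assoc)
      then have "(b\<^sup>2 * t) * (- x) = (b\<^sup>2 * t) * (1 / (2 - b))" by (simp add: ac_simps)
      then have "- x = 1 / (2 - b)" using that assms(1) by (simp only: mult_cancel_left) simp
      moreover have "0 < 1 / (2 - b)" using assms(2) by simp
      ultimately show False using \<open>0 \<le> x\<close> by linarith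
    qed
    then show ?thesis using that[of 1] True by auto
  next
    case False
    define d where "d = \<bar>b - a\<bar> / K"
    have "0 < d" using False K by (simp add: d_def)
    moreover have "t \<in> hit_parameters b a \<longleftrightarrow> 0 < t * (b - a)" if "t \<noteq> 0" "\<bar>t\<bar> < d" for t
    proof -
      define y where "y = b - a - t * a * b"
      define w where "w = b\<^sup>2 * t / (2 - b)"
      have "\<bar>t\<bar> * K < \<bar>b - a\<bar>" using that K by (simp add: d_def field_simps)
      moreover have "\<bar>t\<bar> * K = \<bar>t * a * b\<bar> + \<bar>w\<bar>"
        using assms by (simp add: K_def w_def abs_mult algebra_simps)
      ultimately have less: "\<bar>t * a * b\<bar> + \<bar>w\<bar> < \<bar>b - a\<bar>" by simp
      then have y: "y \<noteq> 0" "\<bar>w\<bar> \<le> \<bar>y\<bar>" "0 < y \<longleftrightarrow> 0 < b - a"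
        unfolding y_def by linarith+
      have w: "w \<noteq> 0" "0 < w \<longleftrightarrow> 0 < t"
        using assms that by (auto simp: w_def zero_less_mult_iff zero_less_divide_iff)
      have sgn: "0 < w * y \<longleftrightarrow> 0 < t * (b - a)"
        using y w that False unfolding zero_less_mult_iff by linarith
      have "(\<exists>x. 0 \<le> x \<and> x \<le> 1 \<and> x * y = w) \<longleftrightarrow> 0 < w * y"
      proof
        assume "\<exists>x. 0 \<le> x \<and> x \<le> 1 \<and> x * y = w"
        then obtain x where "0 \<le> x" "x * y = w" by blast
        then have "0 \<le> w * y" by (metis mult.assoc mult_nonneg_nonneg zero_le_square)
        then show "0 < w * y" using w y by (simp add: less_le)
      next
        assume "0 < w * y"
        then have "0 \<le> w / y" "w / y \<le> 1"
          using y by (auto simp: zero_less_mult_iff zero_le_divide_iff divide_le_eq_1)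
        then show "\<exists>x. 0 \<le> x \<and> x \<le> 1 \<and> x * y = w"
          using y by (intro exI[of _ "w / y"]) simp
      qed
      then show ?thesis unfolding mem sgn[symmetric] y_def w_def .
    qed
    ultimately show ?thesis using that by blast
  qed
qed

section \<open>Parallel polygons, nodes and edges of the ADSS\<close>

context equal_area_vertices
begin

text \<open>Sides keep their lines' directions; the factor vanishes where the side collapses and is
  negative where it is reversed.\<close>

lemma parallel_polygon_next:
  "parallel_polygon P l (i + 1) = parallel_polygon P l i + (1 - l * curvature P i) *\<^sub>R side_vec P i"
proof -
  have "P (i + 1) = P i + side_vec P i" by (simp add: side_vec_def)
  then show ?thesis
    unfolding parallel_polygon_def affine_normal_next by (simp add: algebra_simps)
qed

lemma side_parallel_polygon:
  "side (parallel_polygon P l) i =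
     {parallel_polygon P l i + x *\<^sub>R (1 - l * curvature P i) *\<^sub>R side_vec P i | x. 0 \<le> x \<and> x \<le> 1}"
  unfolding side_alt by (simp add: side_vec_def[of "parallel_polygon P l"] parallel_polygon_next)

text \<open>At this parameter side \<open>i\<close> of the parallel polygon collapses, so the two
  normal lines meet. They meet nowhere else because the affine normal and the side are
  independent.\<close>

lemma evolute_node_eq:
  assumes "curvature P i \<noteq> 0"
  shows "evolute_node P i = parallel_polygon P (1 / curvature P i) i"
    and "evolute_node P i = parallel_polygon P (1 / curvature P i) (i + 1)"
proof -
  let ?b = "curvature P i"
  have eq: "parallel_polygon P (1 / ?b) (i + 1) = parallel_polygon P (1 / ?b) i"
    using assms by (simp add: parallel_polygon_next)
  have uniq: "l = 1 / ?b" if "parallel_polygon P l i = parallel_polygon P m (i + 1)" for l m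
  proof -
    have "bracket (affine_normal P i) (side_vec P i) = - c"
      using bracket_consecutive[of i] by (simp add: affine_normal_def bracket_simps)
    then have "bracket (affine_normal P i) (side_vec P i) \<noteq> 0" using c_nonzero by simp
    moreover have "(m - l) *\<^sub>R affine_normal P i + (1 - m * ?b) *\<^sub>R side_vec P i = 0"
      using that unfolding parallel_polygon_next by (simp add: parallel_polygon_def algebra_simps)
    ultimately have "m - l = 0 \<and> 1 - m * ?b = 0"
      by (rule independent_if_bracket_nonzero)
    then have "m = l" and "m * ?b = 1" by auto
    then show ?thesis using assms by (metis nonzero_eq_divide_eq)
  qed
  have "normal_line P i \<inter> normal_line P (i + 1) = {parallel_polygon P (1 / ?b) i}"
  proof -
    have "x = parallel_polygon P (1 / ?b) i" if "x \<in> normal_line P i \<inter> normal_line P (i + 1)" for x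
      using that uniq unfolding normal_line_def by auto
    moreover have "parallel_polygon P (1 / ?b) i \<in> normal_line P i \<inter> normal_line P (i + 1)"
      unfolding normal_line_def using eq by (metis IntI rangeI)
    ultimately show ?thesis by blast
  qed
  then show "evolute_node P i = parallel_polygon P (1 / ?b) i"
    unfolding evolute_node_def by simp
  then show "evolute_node P i = parallel_polygon P (1 / ?b) (i + 1)"
    using eq by simp
qed

text \<open>The lines of sides \<open>i\<close> and \<open>i + 1\<close> meet only in vertex
  \<open>i + 1\<close>, so vertex \<open>i\<close> can lie on side \<open>i + 1\<close> only when
  side \<open>i\<close> collapses. Conversely, at that moment sides \<open>i - 1\<close> and
  \<open>i + 1\<close> share an end point.\<close>

lemma adss_node_iff:
  assumes "5 \<le> n"
  shows "adss_node n P i (i + 1) M \<longleftrightarrow> curvature P i \<noteq> 0 \<and> M = evolute_node P i"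
proof
  assume "adss_node n P i (i + 1) M"
  then obtain l where M: "M = parallel_polygon P l i" "M \<in> side (parallel_polygon P l) (i + 1)"
    unfolding adss_node_def by blast
  then obtain x where "parallel_polygon P l i = parallel_polygon P l (i + 1)
      + x *\<^sub>R (1 - l * curvature P (i + 1)) *\<^sub>R side_vec P (i + 1)"
    unfolding side_parallel_polygon by blast
  then have "(1 - l * curvature P i) *\<^sub>R side_vec P i
      + (x * (1 - l * curvature P (i + 1))) *\<^sub>R side_vec P (i + 1) = 0"
    unfolding parallel_polygon_next by simp
  moreover have "bracket (side_vec P i) (side_vec P (i + 1)) \<noteq> 0"
    using bracket_consecutive[of "i + 1"] c_nonzero by simp
  ultimately have "1 - l * curvature P i = 0"
    using independent_if_bracket_nonzero by blast
  then have "curvature P i \<noteq> 0" by auto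
  moreover from this have "l = 1 / curvature P i"
    using \<open>1 - l * curvature P i = 0\<close> by (simp add: field_simps)
  ultimately show "curvature P i \<noteq> 0 \<and> M = evolute_node P i"
    using M evolute_node_eq by simp
next
  assume *: "curvature P i \<noteq> 0 \<and> M = evolute_node P i"
  define l where "l = 1 / curvature P i"
  have M: "M = parallel_polygon P l i" "M = parallel_polygon P l (i + 1)"
    using * evolute_node_eq unfolding l_def by blast+
  have sides: "M \<in> side (parallel_polygon P l) (i - 1)" "M \<in> side (parallel_polygon P l) (i + 1)"
    using M vertex_in_side[of "parallel_polygon P l" "i - 1"]
      vertex_in_side[of "parallel_polygon P l" "i + 1"]
    by auto
  moreover have nonadj: "nonadjacent n (i - 1) (i + 1)"
    using assms zmod_zminus1_eq_if[of 2 "int n"] by (simp add: nonadjacent_def)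
  ultimately have "M \<in> adss n P"
    unfolding adss_def adss_points_def
    by (intro subsetD[OF closure_subset]) blast
  moreover have "\<not> int n dvd 1" "\<not> int n dvd 2"
    using assms by (auto dest: zdvd_imp_le)
  ultimately show "adss_node n P i (i + 1) M"
    unfolding adss_node_def using M(1) sides(2) by auto
qed

lemma connected_edges_eq:
  assumes "5 \<le> n"
  shows "connected_edges n P i (i + 1) M = {(i - 1, i + 1)} \<longleftrightarrow>
    end_vertex (adss_edge P (i - 1) (i + 1)) M"
proof -
  have "nonadjacent n (i - 1) (i + 1)" "\<not> nonadjacent n i (i + 1)"
    using assms zmod_zminus1_eq_if[of 2 "int n"] by (auto simp: nonadjacent_def)
  then show ?thesis unfolding connected_edges_def by auto
qed

text \<open>Both sides are written from vertex \<open>i\<close> in the basis of sides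
  \<open>i - 1\<close> and \<open>i\<close>. Comparing coefficients determines the meeting point,
  and \<open>hit_parameters\<close> records that it lies within each side.\<close>

lemma adss_points_eq:
  fixes i
  defines "a \<equiv> curvature P (i - 1)" and "b \<equiv> curvature P i" and "d \<equiv> curvature P (i + 1)"
  assumes "b \<noteq> 0" and "b < 2"
  shows "adss_points P (i - 1) (i + 1) =
    (\<lambda>t. evolute_node P i + t *\<^sub>R (affine_normal P i - (b / (2 - b)) *\<^sub>R side_vec P (i - 1)))
      ` (hit_parameters b a \<inter> hit_parameters b d)" (is "?L = ?R")
proof -
  have node: "parallel_polygon P (1 / b + t) i = evolute_node P i + t *\<^sub>R affine_normal P i" for t
    using evolute_node_eq(1)[of i] \<open>b \<noteq> 0\<close>
    by (simp add: b_def parallel_polygon_def algebra_simps)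
  have left: "side (parallel_polygon P l) (i - 1) =
      {parallel_polygon P l i - (x * (1 - l * a)) *\<^sub>R side_vec P (i - 1) | x. 0 \<le> x \<and> x \<le> 1}" for l
  proof -
    let ?v = "side_vec P (i - 1)" and ?R = "parallel_polygon P l"
    have "?R i = ?R (i - 1) + (1 - l * a) *\<^sub>R ?v"
      using parallel_polygon_next[of l "i - 1"] by (simp add: a_def)
    \<comment> \<open>Side \<open>i - 1\<close> is traversed backwards, from vertex
      \<open>i\<close>, which replaces \<open>x\<close> by \<open>1 - x\<close>.\<close>
    then have flip: "?R (i - 1) + x *\<^sub>R (1 - l * a) *\<^sub>R ?v = ?R i - ((1 - x) * (1 - l * a)) *\<^sub>R ?v" for x
      by (simp add: algebra_simps)
    show ?thesis
      unfolding side_parallel_polygon a_def[symmetric] flip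
    proof (intro equalityI subsetI)
      fix X assume "X \<in> {?R i - ((1 - x) * (1 - l * a)) *\<^sub>R ?v | x. 0 \<le> x \<and> x \<le> 1}"
      then obtain x where "X = ?R i - ((1 - x) * (1 - l * a)) *\<^sub>R ?v" "0 \<le> x" "x \<le> 1" by blast
      then show "X \<in> {?R i - (x * (1 - l * a)) *\<^sub>R ?v | x. 0 \<le> x \<and> x \<le> 1}"
        by (intro CollectI exI[of _ "1 - x"]) simp
    next
      fix X assume "X \<in> {?R i - (x * (1 - l * a)) *\<^sub>R ?v | x. 0 \<le> x \<and> x \<le> 1}"
      then obtain x where "X = ?R i - (x * (1 - l * a)) *\<^sub>R ?v" "0 \<le> x" "x \<le> 1" by blast
      then show "X \<in> {?R i - ((1 - x) * (1 - l * a)) *\<^sub>R ?v | x. 0 \<le> x \<and> x \<le> 1}"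
        by (intro CollectI exI[of _ "1 - x"]) simp
    qed
  qed
  have right: "side (parallel_polygon P l) (i + 1) =
      {parallel_polygon P l i + (1 - l * b + (y * (1 - l * d)) * (2 - b)) *\<^sub>R side_vec P i
        - (y * (1 - l * d)) *\<^sub>R side_vec P (i - 1) | y. 0 \<le> y \<and> y \<le> 1}" for l
    unfolding side_parallel_polygon parallel_polygon_next side_vec_next a_def b_def d_def
    by (simp add: algebra_simps)
  have meet: "parallel_polygon P l i - u *\<^sub>R side_vec P (i - 1) =
      parallel_polygon P l i + (1 - l * b + w * (2 - b)) *\<^sub>R side_vec P i - w *\<^sub>R side_vec P (i - 1)
      \<longleftrightarrow> u = w \<and> w = b * (l - 1 / b) / (2 - b)" for l u w
  proof -
    have "(parallel_polygon P l i - u *\<^sub>R side_vec P (i - 1) =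
      parallel_polygon P l i + (1 - l * b + w * (2 - b)) *\<^sub>R side_vec P i - w *\<^sub>R side_vec P (i - 1))
      \<longleftrightarrow> (u - w) *\<^sub>R side_vec P (i - 1) + (1 - l * b + w * (2 - b)) *\<^sub>R side_vec P i = 0"
      by (auto simp: algebra_simps)
    also have "\<dots> \<longleftrightarrow> u - w = 0 \<and> 1 - l * b + w * (2 - b) = 0"
      using independent_if_bracket_nonzero[of "side_vec P (i - 1)" "side_vec P i" "u - w"]
        bracket_consecutive[of i] c_nonzero by (metis add_0 scale_zero_left)
    also have "\<dots> \<longleftrightarrow> u = w \<and> w = b * (l - 1 / b) / (2 - b)"
    proof -
      have "b * (l - 1 / b) = l * b - 1" using \<open>b \<noteq> 0\<close> by (simp add: field_simps)
      then show ?thesis using \<open>b < 2\<close> by (auto simp: eq_divide_eq)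
    qed
    finally show ?thesis .
  qed
  show ?thesis
  proof (intro equalityI subsetI)
    fix X assume "X \<in> ?L"
    then obtain l where "X \<in> side (parallel_polygon P l) (i - 1)"
      "X \<in> side (parallel_polygon P l) (i + 1)"
      unfolding adss_points_def by blast
    then obtain x y where x: "0 \<le> x" "x \<le> 1" and y: "0 \<le> y" "y \<le> 1"
      and X: "X = parallel_polygon P l i - (x * (1 - l * a)) *\<^sub>R side_vec P (i - 1)"
        "X = parallel_polygon P l i + (1 - l * b + (y * (1 - l * d)) * (2 - b)) *\<^sub>R side_vec P i
          - (y * (1 - l * d)) *\<^sub>R side_vec P (i - 1)"
      unfolding left right by blast
    define t where "t = l - 1 / b"
    have l: "l = 1 / b + t" by (simp add: t_def)
    have xy: "x * (1 - l * a) = b * t / (2 - b)" "y * (1 - l * d) = b * t / (2 - b)"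
      using meet[of l "x * (1 - l * a)" "y * (1 - l * d)"] X unfolding t_def by simp_all
    then have "t \<in> hit_parameters b a \<inter> hit_parameters b d"
      unfolding hit_parameters_def l using x y by blast
    moreover have "parallel_polygon P l i = evolute_node P i + t *\<^sub>R affine_normal P i"
      unfolding l by (rule node)
    then have "X = evolute_node P i
        + t *\<^sub>R (affine_normal P i - (b / (2 - b)) *\<^sub>R side_vec P (i - 1))"
      using X(1) unfolding xy by (simp add: algebra_simps)
    ultimately show "X \<in> ?R" by blast
  next
    fix X assume "X \<in> ?R"
    then obtain t x y where x: "0 \<le> x" "x \<le> 1" and y: "0 \<le> y" "y \<le> 1"
      and xy: "x * (1 - (1 / b + t) * a) = b * t / (2 - b)"
        "y * (1 - (1 / b + t) * d) = b * t / (2 - b)"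
      and X: "X = evolute_node P i
        + t *\<^sub>R (affine_normal P i - (b / (2 - b)) *\<^sub>R side_vec P (i - 1))"
      unfolding hit_parameters_def by blast
    have X1: "X = parallel_polygon P (1 / b + t) i
        - (x * (1 - (1 / b + t) * a)) *\<^sub>R side_vec P (i - 1)"
      unfolding xy node by (simp add: X algebra_simps)
    then have "X = parallel_polygon P (1 / b + t) i
        + (1 - (1 / b + t) * b + (y * (1 - (1 / b + t) * d)) * (2 - b)) *\<^sub>R side_vec P i
        - (y * (1 - (1 / b + t) * d)) *\<^sub>R side_vec P (i - 1)"
      using meet[of "1 / b + t" "x * (1 - (1 / b + t) * a)" "y * (1 - (1 / b + t) * d)"] xy
      by simp
    with X1 have "X \<in> side (parallel_polygon P (1 / b + t)) (i - 1)
        \<inter> side (parallel_polygon P (1 / b + t)) (i + 1)"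
      unfolding left right using x y by blast
    then show "X \<in> ?L" unfolding adss_points_def by blast
  qed
qed

section \<open>Edges and cusps of the evolute\<close>

lemma parallel_polygon_eq_iff: "parallel_polygon P l i = parallel_polygon P m i \<longleftrightarrow> l = m"
  using affine_normal_nonzero by (simp add: parallel_polygon_def)

lemma closed_segment_parallel_polygon:
  "parallel_polygon P l i \<in> closed_segment (parallel_polygon P x i) (parallel_polygon P y i)
     \<longleftrightarrow> l \<in> closed_segment x y"
proof -
  have "(1 - u) *\<^sub>R parallel_polygon P x i + u *\<^sub>R parallel_polygon P y i
      = parallel_polygon P ((1 - u) *\<^sub>R x + u *\<^sub>R y) i" for u
    by (simp add: parallel_polygon_def algebra_simps)
  then show ?thesis
    by (simp add: closed_segment_def parallel_polygon_eq_iff)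
qed

text \<open>The product is 1 at \<open>l = 0\<close>, that is at \<open>P i\<close>, and changes
  sign when a single node is passed; the edge is the part between the nodes that avoids
  \<open>P i\<close>. The strict inequalities leave out the nodes, which belong to the edge in some
  cases only.\<close>

lemma evolute_edge_parameters:
  fixes i
  defines "a \<equiv> curvature P (i - 1)" and "b \<equiv> curvature P i"
  assumes "a \<noteq> 0 \<or> b \<noteq> 0"
  shows "(1 - l * a) * (1 - l * b) < 0 \<Longrightarrow> parallel_polygon P l i \<in> evolute_edge P i"
    and "0 < (1 - l * a) * (1 - l * b) \<Longrightarrow> parallel_polygon P l i \<notin> evolute_edge P i"
proof -
  let ?R = "\<lambda>l. parallel_polygon P l i"
  have A: "evolute_node P (i - 1) = ?R (1 / a)" if "a \<noteq> 0"
    using evolute_node_eq(2)[of "i - 1"] that by (simp add: a_def)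
  have B: "evolute_node P i = ?R (1 / b)" if "b \<noteq> 0"
    using evolute_node_eq(1)[of i] that by (simp add: b_def)
  have half: "?R l \<in> {?R (1 / k) + t *\<^sub>R (?R (1 / k) - P i) | t. 0 \<le> t} \<longleftrightarrow> 1 \<le> l * k"
    if "k \<noteq> 0" for k
  proof -
    have "?R (1 / k) + t *\<^sub>R (?R (1 / k) - P i) = ?R (1 / k + t / k)" for t
      by (simp add: parallel_polygon_def algebra_simps)
    then have "?R l \<in> {?R (1 / k) + t *\<^sub>R (?R (1 / k) - P i) | t. 0 \<le> t} \<longleftrightarrow>
        (\<exists>t\<ge>0. l = 1 / k + t / k)"
      by (auto simp: parallel_polygon_eq_iff)
    also have "\<dots> \<longleftrightarrow> (\<exists>t\<ge>0. l * k = 1 + t)" using that by (simp add: field_simps)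
    also have "\<dots> \<longleftrightarrow> 1 \<le> l * k" by (metis add.commute diff_add_cancel diff_ge_0_iff_ge le_add_same_cancel1)
    finally show ?thesis .
  qed
  have "((1 - l * a) * (1 - l * b) < 0 \<longrightarrow> ?R l \<in> evolute_edge P i) \<and>
    (0 < (1 - l * a) * (1 - l * b) \<longrightarrow> ?R l \<notin> evolute_edge P i)"
  proof (cases "a = 0 \<or> b = 0")
    case True
    then show ?thesis
      using assms(3) half A B
      by (auto simp: evolute_edge_def Let_def a_def[symmetric] b_def[symmetric] simp del: mem_Collect_eq)
  next
    case False
    then have ab: "a \<noteq> 0" "b \<noteq> 0" by auto
    \<comment> \<open>\<open>X\<close> is nonpositive exactly on the segment between the nodes; the
      sign of \<open>a * b\<close> then decides between the segment and its complement.\<close>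
    define X where "X = (l - 1 / a) * (l - 1 / b)"
    have prod: "(1 - l * a) * (1 - l * b) = (a * b) * X"
      using ab by (simp add: X_def field_simps)
    have seg: "l \<in> closed_segment (1 / a) (1 / b) \<longleftrightarrow> X \<le> 0"
      by (auto simp: X_def closed_segment_eq_real_ivl mult_le_0_iff)
    show ?thesis
    proof (cases "a * b > 0")
      case True
      then have "evolute_edge P i = closed_segment (?R (1 / a)) (?R (1 / b))"
        using A B ab by (simp add: evolute_edge_def Let_def a_def[symmetric] b_def[symmetric])
      then have "?R l \<in> evolute_edge P i \<longleftrightarrow> X \<le> 0"
        by (simp only: closed_segment_parallel_polygon seg)
      moreover have "(a * b) * X < 0 \<longleftrightarrow> X < 0" "0 < (a * b) * X \<longleftrightarrow> 0 < X"
        using mult_less_cancel_left_pos[OF True, of X 0] mult_less_cancel_left_pos[OF True, of 0 X]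
        by (simp_all only: mult_zero_right)
      ultimately show ?thesis unfolding prod by linarith
    next
      case False
      then have neg: "a * b < 0" using ab by (simp add: less_le not_less)
      then have "evolute_edge P i = normal_line P i - closed_segment (?R (1 / a)) (?R (1 / b))"
        using A B ab by (simp add: evolute_edge_def Let_def a_def[symmetric] b_def[symmetric])
      then have "?R l \<in> evolute_edge P i \<longleftrightarrow> \<not> X \<le> 0"
        by (simp add: closed_segment_parallel_polygon seg normal_line_def)
      moreover have "(a * b) * X < 0 \<longleftrightarrow> 0 < X" "0 < (a * b) * X \<longleftrightarrow> X < 0"
        using mult_less_cancel_left_neg[OF neg, of X 0] mult_less_cancel_left_neg[OF neg, of 0 X]
        by (simp_all only: mult_zero_right)
      ultimately show ?thesis unfolding prod by linarith
    qed
  qed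
  then show "(1 - l * a) * (1 - l * b) < 0 \<Longrightarrow> ?R l \<in> evolute_edge P i"
    and "0 < (1 - l * a) * (1 - l * b) \<Longrightarrow> ?R l \<notin> evolute_edge P i" by blast+
qed

text \<open>The node with parameter \<open>1/b\<close> on the normal line at \<open>P j\<close>, where \<open>a\<close> is the curvature
  belonging to the other node on that line. Reversing the direction amounts to
  \<open>(a, b) \<mapsto> (-a, -b)\<close>.\<close>

lemma leaves_arrives_iff:
  fixes a b :: real
  assumes "{a, b} = {curvature P (j - 1), curvature P j}" and "b \<noteq> 0"
  defines "Q \<equiv> parallel_polygon P (1 / b) j"
  shows "leaves_from (evolute_edge P j) (affine_normal P j) Q \<longleftrightarrow> a < b"
    and "arrives_at (evolute_edge P j) (affine_normal P j) Q \<longleftrightarrow> b < a"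
proof -
  have mem: "(1 - l * a) * (1 - l * b) < 0 \<Longrightarrow> parallel_polygon P l j \<in> evolute_edge P j"
    "0 < (1 - l * a) * (1 - l * b) \<Longrightarrow> parallel_polygon P l j \<notin> evolute_edge P j" for l
  proof -
    \<comment> \<open>The product is symmetric in the two curvatures, so the node may be either end
      of the edge.\<close>
    have "a = curvature P (j - 1) \<and> b = curvature P j \<or> b = curvature P (j - 1) \<and> a = curvature P j"
      using assms(1) by (auto simp: doubleton_eq_iff)
    then show "(1 - l * a) * (1 - l * b) < 0 \<Longrightarrow> parallel_polygon P l j \<in> evolute_edge P j"
      "0 < (1 - l * a) * (1 - l * b) \<Longrightarrow> parallel_polygon P l j \<notin> evolute_edge P j"
      using evolute_edge_parameters[of j l] \<open>b \<noteq> 0\<close> by (auto simp: mult.commute)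
  qed
  have move: "Q + t *\<^sub>R affine_normal P j = parallel_polygon P (1 / b + t) j"
    "Q - t *\<^sub>R affine_normal P j = parallel_polygon P (1 / b - t) j" for t
    by (simp_all add: Q_def parallel_polygon_def algebra_simps)
  have neg: "(1 - (1 / - b + t) * - a) * (1 - (1 / - b + t) * - b)
      = (1 - (1 / b - t) * a) * (1 - (1 / b - t) * b)" for t
    by (simp add: algebra_simps)
  \<comment> \<open>The filter \<open>at_right 0\<close> is nontrivial, so a property and its
    negation cannot both hold eventually.\<close>
  have clash: "\<not> (\<forall>\<^sub>F t in at_right (0::real). R t)" if "\<forall>\<^sub>F t in at_right (0::real). \<not> R t" for R
    using eventually_happens'[OF _ eventually_conj[OF that]] trivial_limit_at_right_real by blast
  show "leaves_from (evolute_edge P j) (affine_normal P j) Q \<longleftrightarrow> a < b"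
  proof (cases "a < b")
    case True
    then show ?thesis
      using eventually_mono[OF edge_product_sign(1)[OF \<open>b \<noteq> 0\<close> True] mem(1)]
      by (simp add: leaves_from_def move)
  next
    case False
    then show ?thesis
      using clash[OF eventually_mono[OF edge_product_sign(2)[OF \<open>b \<noteq> 0\<close>, of a] mem(2)]]
      by (simp add: leaves_from_def move)
  qed
  show "arrives_at (evolute_edge P j) (affine_normal P j) Q \<longleftrightarrow> b < a"
  proof (cases "b < a")
    case True
    then show ?thesis
      using eventually_mono[OF edge_product_sign(1)[of "- b" "- a", unfolded neg] mem(1)] \<open>b \<noteq> 0\<close>
      by (simp add: arrives_at_def move)
  next
    case False
    then show ?thesis
      using clash[OF eventually_mono[OF edge_product_sign(2)[of "- b" "- a", unfolded neg] mem(2)]] \<open>b \<noteq> 0\<close>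
      by (simp add: arrives_at_def move)
  qed
qed

text \<open>Equal curvatures give coinciding nodes. Conversely, a single point is neither left nor
  reached along the nonzero normal, which excludes both \<open>a < b\<close> and
  \<open>b < a\<close>.\<close>

lemma evolute_edge_degenerate_iff:
  assumes "{a, b} = {curvature P (j - 1), curvature P j}" and "b \<noteq> 0"
  shows "evolute_edge P j = {parallel_polygon P (1 / b) j} \<longleftrightarrow> a = b"
proof
  assume "a = b"
  then have eq: "curvature P (j - 1) = b" "curvature P j = b"
    using assms(1) by (auto simp only: doubleton_eq_iff)
  have "evolute_node P (j - 1) = parallel_polygon P (1 / b) j"
    "evolute_node P j = parallel_polygon P (1 / b) j"
    using evolute_node_eq(2)[of "j - 1"] evolute_node_eq(1)[of j] \<open>b \<noteq> 0\<close>
    unfolding eq diff_add_cancel by blast+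
  moreover have "b * b > 0" using \<open>b \<noteq> 0\<close> by (auto simp: zero_less_mult_iff)
  ultimately show "evolute_edge P j = {parallel_polygon P (1 / b) j}"
    by (simp add: evolute_edge_def eq)
next
  let ?Q = "parallel_polygon P (1 / b) j"
  assume edge: "evolute_edge P j = {?Q}"
  have isolated: "\<not> (\<forall>\<^sub>F t in at_right 0. ?Q + t *\<^sub>R v \<in> {?Q})" if "v \<noteq> 0" for v
  proof
    assume "\<forall>\<^sub>F t in at_right 0. ?Q + t *\<^sub>R v \<in> {?Q}"
    then have "\<forall>\<^sub>F t in at_right (0::real). t = 0" using that by simp
    then show False by (auto simp: eventually_at_right_field dest: dense)
  qed
  have "\<not> leaves_from {?Q} (affine_normal P j) ?Q" "\<not> arrives_at {?Q} (affine_normal P j) ?Q"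
    using isolated[of "affine_normal P j"] isolated[of "- affine_normal P j"] affine_normal_nonzero
    by (simp_all add: leaves_from_def arrives_at_def)
  then show "a = b"
    using leaves_arrives_iff[OF assms] unfolding edge by linarith
qed

text \<open>Coherence means that \<open>b - a\<close> and \<open>b - d\<close> have opposite strict
  signs, and zero differences belong to collapsed edges. Cusps are thus the strict local extrema of
  the curvature sequence, zero curvature excepted.\<close>

lemma evolute_cusp_iff:
  "evolute_cusp P i M \<longleftrightarrow> curvature P i \<noteq> 0 \<and> M = evolute_node P i \<and>
     0 < (curvature P i - curvature P (i - 1)) * (curvature P i - curvature P (i + 1))"
proof (cases "curvature P i = 0")
  case False
  let ?a = "curvature P (i - 1)" and ?b = "curvature P i" and ?d = "curvature P (i + 1)"
  have 1: "{?a, ?b} = {curvature P (i - 1), curvature P i}"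
    and 2: "{?d, ?b} = {curvature P (i + 1 - 1), curvature P (i + 1)}" by auto
  note left = leaves_arrives_iff[OF 1 False, folded evolute_node_eq(1)[OF False]]
    evolute_edge_degenerate_iff[OF 1 False, folded evolute_node_eq(1)[OF False]]
  note right = leaves_arrives_iff[OF 2 False, folded evolute_node_eq(2)[OF False]]
    evolute_edge_degenerate_iff[OF 2 False, folded evolute_node_eq(2)[OF False]]
  have "evolute_edge P i \<noteq> {evolute_node P i} \<and> evolute_edge P (i + 1) \<noteq> {evolute_node P i} \<and>
      \<not> coherently_oriented P i (evolute_node P i) \<longleftrightarrow>
      0 < (?b - ?a) * (?b - ?d)"
    unfolding coherently_oriented_def left right zero_less_mult_iff by linarith
  then show ?thesis unfolding evolute_cusp_def by blast
qed (simp add: evolute_cusp_def)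

section \<open>End vertices at evolute nodes, and the equivalence\<close>

lemma end_vertex_evolute_node_iff:
  assumes "curvature P i \<noteq> 0" and "curvature P i < 2"
  shows "end_vertex (adss_edge P (i - 1) (i + 1)) (evolute_node P i) \<longleftrightarrow>
    0 < (curvature P i - curvature P (i - 1)) * (curvature P i - curvature P (i + 1))"
proof -
  let ?a = "curvature P (i - 1)" and ?b = "curvature P i" and ?d = "curvature P (i + 1)"
  let ?f = "affine_normal P i - (?b / (2 - ?b)) *\<^sub>R side_vec P (i - 1)"
  obtain r where r: "0 < r"
    "\<And>t. t \<noteq> 0 \<Longrightarrow> \<bar>t\<bar> < r \<Longrightarrow> t \<in> hit_parameters ?b ?a \<longleftrightarrow> 0 < t * (?b - ?a)"
    by (rule hit_parameters_near_0[OF assms, of ?a]) blast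
  obtain s where s: "0 < s"
    "\<And>t. t \<noteq> 0 \<Longrightarrow> \<bar>t\<bar> < s \<Longrightarrow> t \<in> hit_parameters ?b ?d \<longleftrightarrow> 0 < t * (?b - ?d)"
    by (rule hit_parameters_near_0[OF assms, of ?d]) blast
  \<comment> \<open>The meeting point really moves with \<open>t\<close>: its velocity has a nonzero
    bracket with side \<open>i - 1\<close>.\<close>
  have "bracket (side_vec P (i - 1)) ?f = c"
    using bracket_consecutive[of i] by (simp add: affine_normal_def bracket_simps)
  then have "?f \<noteq> 0" using c_nonzero by (auto simp: bracket_eq)
  moreover have "0 \<in> hit_parameters ?b ?a \<inter> hit_parameters ?b ?d"
    unfolding hit_parameters_def by (auto intro: exI[of _ 0])
  moreover have "t \<in> hit_parameters ?b ?a \<inter> hit_parameters ?b ?d \<longleftrightarrow>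
      0 < t * (?b - ?a) \<and> 0 < t * (?b - ?d)" if "t \<noteq> 0" "\<bar>t\<bar> < min r s" for t
    using that r s by auto
  moreover have "0 < min r s" using r s by simp
  ultimately show ?thesis
    unfolding adss_edge_def adss_points_eq[OF assms] by (intro end_vertex_line_iff)
qed

end

theorem proposition5p5:
  fixes n :: nat and P :: "int \<Rightarrow> real^2" and i :: int and M :: "real^2"
  assumes "convex_equal_area_polygon n P"
  shows "adss_endpoint n P i M \<longleftrightarrow> evolute_cusp P i M"
proof -
  have n: "5 \<le> n" and simple: "simple_polygon n P" and convex: "bounds_convex_domain P"
    and equal: "\<And>i. bracket (side_vec P (i - 1)) (side_vec P i)
        = bracket (side_vec P i) (side_vec P (i + 1))"
    using assms unfolding convex_equal_area_polygon_def by blast+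
  define c where "c = bracket (side_vec P (- 1)) (side_vec P 0)"
  \<comment> \<open>The equality of neighbouring determinants is carried from index 0 in both
    directions.\<close>
  have c: "bracket (side_vec P (i - 1)) (side_vec P i) = c" for i
  proof (induction i rule: int_induct[where k = 0])
    case base
    show ?case by (simp add: c_def)
  next
    case (step1 i)
    then show ?case using equal[of i] by simp
  next
    case (step2 i)
    then show ?case using equal[of "i - 1"] by simp
  qed
  have "c \<noteq> 0"
    using bracket_nonzero_if_constant[OF n simple] c by (metis add_diff_cancel_right')
  then interpret equal_area_vertices P c
    using c by unfold_locales
  show ?thesis
    unfolding adss_endpoint_def adss_node_iff[OF n] connected_edges_eq[OF n] evolute_cusp_iff
    using end_vertex_evolute_node_iff curvature_less_2[OF n simple convex] by blast
qed

end
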